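(* A poset $\mathbf{P}$ is minimal $(\mathbf{V}_{1,1},\mathbf{V}_{2,2})$-Ramsey if and only if it is isomorphic to \[\mathbf{B}_4-\{S_1,S_2,[4]\}\] for some pair of distinct nonempty sets $S_1,S_2\in\mathbf{B}_4-\{[4]\}$ with either $S_1=S_2^c$ or $|S_1|=|S_2|=2$.
   Context: The Boolean lattice $\mathbf{B}_N$ is the poset $(2^{[N]},\subseteq)$ of all subsets of $[N]=\{1,\dots,N\}$ ordered by inclusion; $\mathbf{B}_4-\{S_1,S_2,[4]\}$ denotes the subposet of $\mathbf{B}_4$ obtained by deleting these three sets, with induced order, and $X^c=[4]\setminus X$. A poset $\mathbf{Q}$ contains a poset $\mathbf{P}$ as a subposet if there is an injection $\phi$ with $x\le_{\mathbf{P}} y$ if and only if $\phi(x)\le_{\mathbf{Q}}\phi(y)$. $\mathbf{V}_{m,m}$ is the poset on elements $x,y_1,\dots,y_m,z_1,\dots,z_m$ with order generated by $x<y_1<\cdots<y_m$ and $x<z_1<\cdots<z_m$. $R(\mathbf{V}_{1,1},\mathbf{V}_{2,2})=4$, where $R(\mathbf{P}_1,\mathbf{P}_2)$ is the minimum $N$ such that every coloring of $\mathbf{B}_N$ with colors $1,2$ contains a subposet isomorphic to $\mathbf{P}_1$ all of color $1$ or a subposet isomorphic to $\mathbf{P}_2$ all of color $2$. A subposet $\mathbf{Q}\subseteq\mathbf{B}_4$ is minimal $(\mathbf{V}_{1,1},\mathbf{V}_{2,2})$-Ramsey if every 2-coloring of $\mathbf{Q}$ contains a subposet isomorphic to $\mathbf{V}_{1,1}$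 of color 1 or a subposet isomorphic to $\mathbf{V}_{2,2}$ of color 2, but for every subposet $\mathbf{Q}'\subset\mathbf{Q}$ with $|\mathbf{Q}'|=|\mathbf{Q}|-1$ there is a 2-coloring of $\mathbf{Q}'$ with neither. *)

theory Defs
  imports Main
begin

text \<open>A poset is given by its reflexive order relation \<open>r\<close>, its ground set being \<open>Field r\<close>;
  the induced subposet on \<open>A \<subseteq> Field r\<close> is \<open>Restr r A\<close>.\<close>

definition poset_embedding :: "'a rel \<Rightarrow> 'b rel \<Rightarrow> ('a \<Rightarrow> 'b) \<Rightarrow> bool" where
  "poset_embedding p q f \<longleftrightarrow>
     inj_on f (Field p) \<and> f ` Field p \<subseteq> Field q \<and>
     (\<forall>x\<in>Field p. \<forall>y\<in>Field p. (x, y) \<in> p \<longleftrightarrow> (f x, f y) \<in> q)"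

definition contains_poset :: "'b rel \<Rightarrow> 'a rel \<Rightarrow> bool" where
  "contains_poset q p \<longleftrightarrow> (\<exists>f. poset_embedding p q f)"

definition poset_isomorphic :: "'a rel \<Rightarrow> 'b rel \<Rightarrow> bool" where
  "poset_isomorphic p q \<longleftrightarrow> (\<exists>f. poset_embedding p q f \<and> f ` Field p = Field q)"

definition boolean_lattice :: "nat \<Rightarrow> nat set rel" where
  "boolean_lattice N = relation_of (\<subseteq>) (Pow {1..N})"

datatype vee_elem = Vx | Vy nat | Vz nat

definition vee_carrier :: "nat \<Rightarrow> nat \<Rightarrow> vee_elem set" where
  "vee_carrier m n = {Vx} \<union> Vy ` {1..m} \<union> Vz ` {1..n}"

definition vee_gens :: "vee_elem rel" where
  "vee_gens = {(Vx, Vy 1), (Vx, Vz 1)} \<union>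
     {(Vy i, Vy (Suc i)) |i. 1 \<le> i} \<union> {(Vz i, Vz (Suc i)) |i. 1 \<le> i}"

text \<open>The generators climb two infinite chains above \<open>Vx\<close>; as the carrier is closed downwards along
  them, generating the order before or after restricting to the carrier makes no difference.\<close>

definition vee :: "nat \<Rightarrow> nat \<Rightarrow> vee_elem rel" where
  "vee m n = Restr (vee_gens\<^sup>*) (vee_carrier m n)"

definition ramsey_for :: "'a rel \<Rightarrow> 'b rel \<Rightarrow> 'c rel \<Rightarrow> bool" where
  "ramsey_for q p1 p2 \<longleftrightarrow>
     (\<forall>c :: 'a \<Rightarrow> nat. c ` Field q \<subseteq> {1, 2} \<longrightarrow>
        contains_poset (Restr q {v \<in> Field q. c v = 1}) p1 \<or>
        contains_poset (Restr q {v \<in> Field q. c v = 2}) p2)"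

text \<open>Minimality is a notion for subposets of a fixed Boolean lattice \<open>\<^bold>B\<^sub>N\<close>; for an abstract
  poset this is the requirement that it embeds into \<open>\<^bold>B\<^sub>N\<close>. In particular \<open>q\<close> is finite.\<close>

definition minimal_ramsey :: "nat \<Rightarrow> 'b rel \<Rightarrow> 'c rel \<Rightarrow> 'a rel \<Rightarrow> bool" where
  "minimal_ramsey N p1 p2 q \<longleftrightarrow>
     contains_poset (boolean_lattice N) q \<and>
     ramsey_for q p1 p2 \<and>
     (\<forall>A. A \<subset> Field q \<and> card A = card (Field q) - 1 \<longrightarrow> \<not> ramsey_for (Restr q A) p1 p2)"

end

theory Submission
  imports Defs
begin

text \<open>A poset embedded in \<open>\<^bold>B\<^sub>4\<close> is a family \<open>F\<close> of subsets of \<open>{1..4}\<close>, and being Ramsey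
  depends only on \<open>F\<close> and is monotone in it. So it suffices to see that \<open>F\<close> is Ramsey exactly if the
  proper subsets of \<open>{1..4}\<close> missing from \<open>F\<close> are covered by a good pair: two complementary nonempty
  sets or two distinct sets of size 2. All families left by good pairs have 13 members, so none of
  them properly contains another, and they are the minimal ones.
  The minimal sets not covered by a good pair are \<open>{\<emptyset>}\<close>, the pairs that are not good and the triples of
  sets of size 2; up to permutations of \<open>{1..4}\<close> there are 11 of them, and deleting each of them
  leaves a family with an explicit good colouring. Up to permutations there are 3 good pairs, and
  for each of them the colouring conditions on the remaining 13 sets are propositionally
  unsatisfiable.\<close>

section \<open>From posets to families of sets\<close>

definition has_V11 :: "'a set set \<Rightarrow> bool" where
  "has_V11 F \<longleftrightarrow> (\<exists>x\<in>F. \<exists>y\<in>F. \<exists>z\<in>F. x \<subset> y \<and> x \<subset> z \<and> \<not> y \<subseteq> z \<and> \<not> z \<subseteq> y)"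

text \<open>Two incomparabilities suffice below: together with \<open>y \<subset> y'\<close> and \<open>z \<subset> z'\<close> they imply the others.\<close>

definition has_V22 :: "'a set set \<Rightarrow> bool" where
  "has_V22 F \<longleftrightarrow> (\<exists>x\<in>F. \<exists>y\<in>F. \<exists>y'\<in>F. \<exists>z\<in>F. \<exists>z'\<in>F.
     x \<subset> y \<and> y \<subset> y' \<and> x \<subset> z \<and> z \<subset> z' \<and> \<not> y \<subseteq> z' \<and> \<not> z \<subseteq> y')"

text \<open>A colouring is encoded by its class \<open>A\<close> of colour 1; \<open>F - A\<close>
  is then the class of colour 2.\<close>

definition arrows :: "'a set set \<Rightarrow> bool" where
  "arrows F \<longleftrightarrow> (\<forall>A\<subseteq>F. has_V11 A \<or> has_V22 (F - A))"

text \<open>A closed form for the generated order. The alternatives \<open>i = j\<close> account for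
  \<open>Vy 0\<close> and \<open>Vz 0\<close>, which no generator meets and which are related only
  to themselves.\<close>

fun vee_le :: "vee_elem \<Rightarrow> vee_elem \<Rightarrow> bool" where
  "vee_le Vx Vx = True"
| "vee_le Vx (Vy j) = (1 \<le> j)"
| "vee_le Vx (Vz j) = (1 \<le> j)"
| "vee_le (Vy i) (Vy j) = (i = j \<or> 1 \<le> i \<and> i \<le> j)"
| "vee_le (Vz i) (Vz j) = (i = j \<or> 1 \<le> i \<and> i \<le> j)"
| "vee_le _ _ = False"

lemma vee_gens_imp_vee_le:
  assumes "(u, v) \<in> vee_gens\<^sup>*"
  shows "vee_le u v"
  using assms
proof (induction rule: rtrancl_induct)
  case base
  show ?case by (cases u) auto
next
  case (step v w)
  from step.hyps(2) step.IH show ?case unfolding vee_gens_def by (cases u) auto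
qed

lemma vee_gens_chain:
  assumes "1 \<le> i" "i \<le> j"
  shows "(Vy i, Vy j) \<in> vee_gens\<^sup>*" "(Vz i, Vz j) \<in> vee_gens\<^sup>*"
  using assms(2,1)
proof (induction j rule: dec_induct)
  case (step j)
  { case 1
    with step show ?case by (auto simp: vee_gens_def intro: rtrancl_into_rtrancl) }
  { case 2
    with step show ?case by (auto simp: vee_gens_def intro: rtrancl_into_rtrancl) }
qed auto

lemma vee_gens_rtrancl_iff: "(u, v) \<in> vee_gens\<^sup>* \<longleftrightarrow> vee_le u v"
proof
  have "(Vx, Vy 1) \<in> vee_gens\<^sup>*" "(Vx, Vz 1) \<in> vee_gens\<^sup>*"
    by (auto simp: vee_gens_def)
  then have "(Vx, Vy j) \<in> vee_gens\<^sup>*" "(Vx, Vz j) \<in> vee_gens\<^sup>*" if "1 \<le> j" for j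
    using vee_gens_chain[of 1 j] that by (meson order_refl rtrancl_trans)+
  moreover assume "vee_le u v"
  ultimately show "(u, v) \<in> vee_gens\<^sup>*"
    using vee_gens_chain by (cases u; cases v) auto
qed (rule vee_gens_imp_vee_le)

lemma vee_iff: "(u, v) \<in> vee m n \<longleftrightarrow> u \<in> vee_carrier m n \<and> v \<in> vee_carrier m n \<and> vee_le u v"
  by (auto simp: vee_def vee_gens_rtrancl_iff)

lemma Field_vee: "Field (vee m n) = vee_carrier m n"
proof -
  have "vee_le u u" for u by (cases u) auto
  then show ?thesis by (fastforce simp: Field_def Domain_iff Range_iff vee_iff)
qed

lemma vee_carriers:
  "vee_carrier 1 1 = {Vx, Vy 1, Vz 1}"
  "vee_carrier 2 2 = {Vx, Vy 1, Vy 2, Vz 1, Vz 2}"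
  by (auto simp: vee_carrier_def numeral_2_eq_2 atLeastAtMostSuc_conv)

section \<open>Induced subposets and embeddings into Boolean lattices\<close>

lemma Partial_order_Restr:
  assumes "Partial_order q" "A \<subseteq> Field q"
  shows "Partial_order (Restr q A)" "Field (Restr q A) = A"
proof -
  have "(x, x) \<in> q" if "x \<in> Field q" for x
    using assms(1) that by (auto simp: order_on_defs dest: refl_onD)
  then show F: "Field (Restr q A) = A"
    using assms(2) by (fastforce simp: Field_def)
  show "Partial_order (Restr q A)"
    unfolding F using assms
    by (auto simp: partial_order_on_def preorder_on_def refl_on_def antisym_Restr trans_Restr)
qed

lemma boolean_lattice_iff: "(S, T) \<in> boolean_lattice N \<longleftrightarrow> S \<subseteq> T \<and> T \<subseteq> {1..N}"
  by (auto simp: boolean_lattice_def relation_of_def)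

lemma Field_boolean_lattice: "Field (boolean_lattice N) = Pow {1..N}"
  by (fastforce simp: Field_def Domain_iff Range_iff boolean_lattice_iff)

lemma Partial_order_boolean_lattice: "Partial_order (boolean_lattice N)"
  unfolding order_on_defs Field_boolean_lattice
  by (fastforce simp: refl_on_def trans_def antisym_def boolean_lattice_iff)

lemma embedding_boolean_lattice_iff:
  "poset_embedding q (boolean_lattice N) f \<longleftrightarrow> inj_on f (Field q) \<and> f ` Field q \<subseteq> Pow {1..N} \<and>
     (\<forall>x\<in>Field q. \<forall>y\<in>Field q. (x, y) \<in> q \<longleftrightarrow> f x \<subseteq> f y)"
  by (fastforce simp: poset_embedding_def boolean_lattice_iff Field_boolean_lattice)

lemma poset_isomorphic_Restr_iff:
  assumes "F \<subseteq> Pow {1..N}"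
  shows "poset_isomorphic q (Restr (boolean_lattice N) F) \<longleftrightarrow>
    (\<exists>f. poset_embedding q (boolean_lattice N) f \<and> f ` Field q = F)"
proof -
  have Field: "Field (Restr (boolean_lattice N) F) = F"
    by (rule Partial_order_Restr(2)[OF Partial_order_boolean_lattice])
       (use assms in \<open>simp add: Field_boolean_lattice\<close>)
  have "poset_embedding q (Restr (boolean_lattice N) F) f \<longleftrightarrow> poset_embedding q (boolean_lattice N) f"
    if im: "f ` Field q = F" for f
  proof -
    have "f x \<in> F" if "x \<in> Field q" for x
      using im that by blast
    then show ?thesis
      using im assms unfolding poset_embedding_def Field Field_boolean_lattice
      by (simp cong: ball_cong)
  qed
  then show ?thesis
    unfolding poset_isomorphic_def Field by metis
qed

lemma poset_embedding_Restr:
  assumes "Partial_order q" "poset_embedding q r f" "A \<subseteq> Field q"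
  shows "poset_embedding (Restr q A) r f"
  using assms Partial_order_Restr[OF assms(1,3)]
  by (auto simp: poset_embedding_def subset_iff intro: inj_on_subset)

text \<open>A copy \<open>g\<close> of the vee in \<open>q\<close> composes with \<open>f\<close> to
  give \<open>h\<close>; conversely, \<open>h\<close> is pulled back along the inverse of
  \<open>f\<close>. Injectivity is implicit on the right-hand side, because \<open>h\<close>
  reflects an antisymmetric order.\<close>

lemma contains_vee_iff:
  assumes "poset_embedding q (boolean_lattice N) f"
  shows "contains_poset q (vee m n) \<longleftrightarrow> (\<exists>h. h ` vee_carrier m n \<subseteq> f ` Field q \<and>
    (\<forall>u\<in>vee_carrier m n. \<forall>v\<in>vee_carrier m n. h u \<subseteq> h v \<longleftrightarrow> vee_le u v))"
proof
  assume "contains_poset q (vee m n)"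
  then obtain g where emb: "poset_embedding (vee m n) q g"
    unfolding contains_poset_def by blast
  then have g: "g ` vee_carrier m n \<subseteq> Field q"
    by (simp add: poset_embedding_def Field_vee)
  have "f (g u) \<subseteq> f (g v) \<longleftrightarrow> vee_le u v" if "u \<in> vee_carrier m n" "v \<in> vee_carrier m n" for u v
  proof -
    have "(g u, g v) \<in> q \<longleftrightarrow> vee_le u v"
      using emb that by (simp add: poset_embedding_def Field_vee vee_iff)
    then show ?thesis
      using assms g that by (simp add: embedding_boolean_lattice_iff image_subset_iff)
  qed
  then show "\<exists>h. h ` vee_carrier m n \<subseteq> f ` Field q \<and>
    (\<forall>u\<in>vee_carrier m n. \<forall>v\<in>vee_carrier m n. h u \<subseteq> h v \<longleftrightarrow> vee_le u v)"
    using g by (intro exI[of _ "\<lambda>u. f (g u)"]) auto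
next
  assume "\<exists>h. h ` vee_carrier m n \<subseteq> f ` Field q \<and>
    (\<forall>u\<in>vee_carrier m n. \<forall>v\<in>vee_carrier m n. h u \<subseteq> h v \<longleftrightarrow> vee_le u v)"
  then obtain h where h: "h ` vee_carrier m n \<subseteq> f ` Field q"
    and le: "\<forall>u\<in>vee_carrier m n. \<forall>v\<in>vee_carrier m n. h u \<subseteq> h v \<longleftrightarrow> vee_le u v"
    by (elim exE conjE)
  define g where "g = (\<lambda>u. inv_into (Field q) f (h u))"
  have g: "g u \<in> Field q" "f (g u) = h u" if "u \<in> vee_carrier m n" for u
    using h that by (auto simp: g_def inv_into_into f_inv_into_f)
  have "(u, v) \<in> vee m n \<longleftrightarrow> (g u, g v) \<in> q" if "u \<in> vee_carrier m n" "v \<in> vee_carrier m n" for u v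
    using assms g that le by (simp add: embedding_boolean_lattice_iff vee_iff)
  moreover have "inj_on g (vee_carrier m n)"
  proof (rule inj_onI)
    fix u v assume uv: "u \<in> vee_carrier m n" "v \<in> vee_carrier m n" "g u = g v"
    then have "vee_le u v" "vee_le v u"
      using le g(2) by (metis order_refl)+
    then show "u = v"
      by (cases u; cases v) auto
  qed
  ultimately have "poset_embedding (vee m n) q g"
    using g(1) by (simp add: poset_embedding_def Field_vee image_subset_iff)
  then show "contains_poset q (vee m n)"
    unfolding contains_poset_def by blast
qed

lemma contains_vee_11_iff:
  assumes "poset_embedding q (boolean_lattice N) f"
  shows "contains_poset q (vee 1 1) \<longleftrightarrow> has_V11 (f ` Field q)"
  unfolding contains_vee_iff[OF assms] vee_carriers
proof
  assume "has_V11 (f ` Field q)"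
  then obtain x y z where "x \<in> f ` Field q" "y \<in> f ` Field q" "z \<in> f ` Field q"
    and "x \<subset> y" "x \<subset> z" "\<not> y \<subseteq> z" "\<not> z \<subseteq> y"
    unfolding has_V11_def by blast
  then show "\<exists>h. h ` {Vx, Vy 1, Vz 1} \<subseteq> f ` Field q \<and>
      (\<forall>u\<in>{Vx, Vy 1, Vz 1}. \<forall>v\<in>{Vx, Vy 1, Vz 1}. h u \<subseteq> h v \<longleftrightarrow> vee_le u v)"
    by (intro exI[of _ "case_vee_elem x (\<lambda>_. y) (\<lambda>_. z)"]) (simp add: less_le_not_le)
next
  assume "\<exists>h. h ` {Vx, Vy 1, Vz 1} \<subseteq> f ` Field q \<and>
      (\<forall>u\<in>{Vx, Vy 1, Vz 1}. \<forall>v\<in>{Vx, Vy 1, Vz 1}. h u \<subseteq> h v \<longleftrightarrow> vee_le u v)"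
  then obtain h where h: "h ` {Vx, Vy 1, Vz 1} \<subseteq> f ` Field q"
      "\<forall>u\<in>{Vx, Vy 1, Vz 1}. \<forall>v\<in>{Vx, Vy 1, Vz 1}. h u \<subseteq> h v \<longleftrightarrow> vee_le u v"
    by (elim exE conjE)
  show "has_V11 (f ` Field q)"
    unfolding has_V11_def less_le_not_le
    by (rule bexI[of _ "h Vx"], rule bexI[of _ "h (Vy 1)"], rule bexI[of _ "h (Vz 1)"])
       (use h in simp_all)
qed

lemma contains_vee_22_iff:
  assumes "poset_embedding q (boolean_lattice N) f"
  shows "contains_poset q (vee 2 2) \<longleftrightarrow> has_V22 (f ` Field q)"
  unfolding contains_vee_iff[OF assms] vee_carriers
proof
  assume "has_V22 (f ` Field q)"
  then obtain x y y' z z' where "x \<in> f ` Field q" "y \<in> f ` Field q" "y' \<in> f ` Field q"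
      "z \<in> f ` Field q" "z' \<in> f ` Field q"
    and *: "x \<subset> y" "y \<subset> y'" "x \<subset> z" "z \<subset> z'" "\<not> y \<subseteq> z'" "\<not> z \<subseteq> y'"
    unfolding has_V22_def by (elim bexE conjE)
  moreover from * have "x \<subset> y'" "x \<subset> z'" "\<not> y \<subseteq> z" "\<not> z \<subseteq> y" "\<not> y' \<subseteq> z" "\<not> z' \<subseteq> y"
     "\<not> y' \<subseteq> z'" "\<not> z' \<subseteq> y'"
    by blast+
  ultimately show "\<exists>h. h ` {Vx, Vy 1, Vy 2, Vz 1, Vz 2} \<subseteq> f ` Field q \<and>
      (\<forall>u\<in>{Vx, Vy 1, Vy 2, Vz 1, Vz 2}. \<forall>v\<in>{Vx, Vy 1, Vy 2, Vz 1, Vz 2}.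
         h u \<subseteq> h v \<longleftrightarrow> vee_le u v)"
    \<comment> \<open>Besides 1, the only index in the carrier is 2, which receives the upper
      elements.\<close>
    by (intro exI[of _ "case_vee_elem x (\<lambda>i. if i = 1 then y else y') (\<lambda>i. if i = 1 then z else z')"])
       (simp add: less_le_not_le)
next
  assume "\<exists>h. h ` {Vx, Vy 1, Vy 2, Vz 1, Vz 2} \<subseteq> f ` Field q \<and>
      (\<forall>u\<in>{Vx, Vy 1, Vy 2, Vz 1, Vz 2}. \<forall>v\<in>{Vx, Vy 1, Vy 2, Vz 1, Vz 2}.
         h u \<subseteq> h v \<longleftrightarrow> vee_le u v)"
  then obtain h where h: "h ` {Vx, Vy 1, Vy 2, Vz 1, Vz 2} \<subseteq> f ` Field q"
      "\<forall>u\<in>{Vx, Vy 1, Vy 2, Vz 1, Vz 2}. \<forall>v\<in>{Vx, Vy 1, Vy 2, Vz 1, Vz 2}.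
         h u \<subseteq> h v \<longleftrightarrow> vee_le u v"
    by (elim exE conjE)
  show "has_V22 (f ` Field q)"
    unfolding has_V22_def less_le_not_le
    by (rule bexI[of _ "h Vx"], rule bexI[of _ "h (Vy 1)"], rule bexI[of _ "h (Vy 2)"],
        rule bexI[of _ "h (Vz 1)"], rule bexI[of _ "h (Vz 2)"])
       (use h in simp_all)
qed

text \<open>A class of colour 1 and its image under \<open>f\<close> determine each other, and
  injectivity of \<open>f\<close> sends the class of colour 2 to the complement within the
  image.\<close>

lemma ramsey_for_vee_iff:
  assumes "Partial_order q" "poset_embedding q (boolean_lattice N) f"
  shows "ramsey_for q (vee 1 1) (vee 2 2) \<longleftrightarrow> arrows (f ` Field q)"
proof -
  have inj: "inj_on f (Field q)"
    using assms(2) by (simp add: poset_embedding_def)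
  have 11: "contains_poset (Restr q A) (vee 1 1) \<longleftrightarrow> has_V11 (f ` A)"
    and 22: "contains_poset (Restr q A) (vee 2 2) \<longleftrightarrow> has_V22 (f ` A)" if "A \<subseteq> Field q" for A
    using contains_vee_11_iff contains_vee_22_iff poset_embedding_Restr[OF assms that]
      Partial_order_Restr(2)[OF assms(1) that] by metis+
  show ?thesis
  proof
    assume ramsey: "ramsey_for q (vee 1 1) (vee 2 2)"
    show "arrows (f ` Field q)"
      unfolding arrows_def
    proof (intro allI impI)
      fix A assume "A \<subseteq> f ` Field q"
      then obtain C where C: "C \<subseteq> Field q" "A = f ` C"
        by (auto simp: subset_image_iff)
      define c :: "'a \<Rightarrow> nat" where "c = (\<lambda>v. if v \<in> C then 1 else 2)"
      have colours: "{v \<in> Field q. c v = 1} = C" "{v \<in> Field q. c v = 2} = Field q - C"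
        using C(1) by (auto simp: c_def)
      have "c ` Field q \<subseteq> {1, 2}"
        by (auto simp: c_def)
      then have "has_V11 (f ` C) \<or> has_V22 (f ` (Field q - C))"
        using ramsey[unfolded ramsey_for_def, rule_format, of c] 11[of C] 22[of "Field q - C"] C(1)
        unfolding colours by simp
      then show "has_V11 A \<or> has_V22 (f ` Field q - A)"
        using C inj by (simp add: inj_on_image_set_diff)
    qed
  next
    assume arrows: "arrows (f ` Field q)"
    show "ramsey_for q (vee 1 1) (vee 2 2)"
      unfolding ramsey_for_def
    proof (intro allI impI)
      fix c :: "'a \<Rightarrow> nat" assume "c ` Field q \<subseteq> {1, 2}"
      then have "f ` Field q - f ` {v \<in> Field q. c v = 1} = f ` {v \<in> Field q. c v = 2}"
        using inj by (auto simp: inj_on_def)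
      moreover have "f ` {v \<in> Field q. c v = 1} \<subseteq> f ` Field q"
        by auto
      ultimately have "has_V11 (f ` {v \<in> Field q. c v = 1}) \<or> has_V22 (f ` {v \<in> Field q. c v = 2})"
        using arrows[unfolded arrows_def, rule_format, of "f ` {v \<in> Field q. c v = 1}"] by simp
      then show "contains_poset (Restr q {v \<in> Field q. c v = 1}) (vee 1 1) \<or>
          contains_poset (Restr q {v \<in> Field q. c v = 2}) (vee 2 2)"
        by (subst 11 22, blast)+
    qed
  qed
qed

lemma minimal_ramsey_vee_iff:
  assumes "Partial_order q" "poset_embedding q (boolean_lattice N) f"
  shows "minimal_ramsey N (vee 1 1) (vee 2 2) q \<longleftrightarrow>
    arrows (f ` Field q) \<and> (\<forall>S\<in>f ` Field q. \<not> arrows (f ` Field q - {S}))"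
proof -
  have inj: "inj_on f (Field q)" and sub: "f ` Field q \<subseteq> Pow {1..N}"
    using assms(2) by (auto simp: embedding_boolean_lattice_iff)
  then have fin: "finite (Field q)"
    by (meson finite_Pow_iff finite_atLeastAtMost finite_imageD finite_subset)
  have del: "ramsey_for (Restr q (Field q - {x})) (vee 1 1) (vee 2 2) \<longleftrightarrow> arrows (f ` Field q - {f x})"
    if "x \<in> Field q" for x
    using ramsey_for_vee_iff[OF Partial_order_Restr(1) poset_embedding_Restr, OF assms(1) _ assms, of "Field q - {x}"]
      Partial_order_Restr(2)[OF assms(1), of "Field q - {x}"] that inj
    by (simp add: inj_on_image_set_diff)
  \<comment> \<open>The field of \<open>q\<close> is finite, and it is nonempty once it has a proper
    subset, so the natural number subtraction does not truncate.\<close>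
  have "A \<subset> Field q \<and> card A = card (Field q) - 1 \<longleftrightarrow> (\<exists>x\<in>Field q. A = Field q - {x})" for A
  proof
    assume A: "A \<subset> Field q \<and> card A = card (Field q) - 1"
    then have "card (Field q - A) = 1"
      using fin psubset_card_mono[OF fin, of A] by (auto simp: card_Diff_subset finite_subset psubset_imp_subset)
    then obtain x where "Field q - A = {x}"
      by (rule card_1_singletonE)
    with A show "\<exists>x\<in>Field q. A = Field q - {x}" by blast
  qed auto
  then have "(\<forall>A. A \<subset> Field q \<and> card A = card (Field q) - 1 \<longrightarrow>
        \<not> ramsey_for (Restr q A) (vee 1 1) (vee 2 2)) \<longleftrightarrow>
      (\<forall>x\<in>Field q. \<not> ramsey_for (Restr q (Field q - {x})) (vee 1 1) (vee 2 2))"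
    by (simp only:) (intro iffI ballI allI impI; elim bexE allE impE; blast)
  then show ?thesis
    using assms(2) ramsey_for_vee_iff[OF assms] del
    by (auto simp: minimal_ramsey_def contains_poset_def simp del: One_nat_def)
qed

section \<open>Monotonicity and symmetry\<close>

lemma has_V11_mono: "has_V11 F \<Longrightarrow> F \<subseteq> G \<Longrightarrow> has_V11 G"
  unfolding has_V11_def by (meson subsetD)

lemma has_V22_mono: "has_V22 F \<Longrightarrow> F \<subseteq> G \<Longrightarrow> has_V22 G"
  unfolding has_V22_def by (meson subsetD)

text \<open>A colouring of \<open>G\<close> restricts to the colouring of \<open>F\<close> given by
  \<open>A \<inter> F\<close>, and a copy found there is also one in \<open>G\<close>.\<close>

lemma arrows_mono:
  assumes "arrows F" "F \<subseteq> G"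
  shows "arrows G"
  unfolding arrows_def
proof (intro allI impI)
  fix A assume "A \<subseteq> G"
  have "has_V11 (A \<inter> F) \<or> has_V22 (F - (A \<inter> F))"
    using assms(1) by (simp add: arrows_def)
  then show "has_V11 A \<or> has_V22 (G - A)"
    using assms(2) has_V11_mono[of "A \<inter> F" A] has_V22_mono[of "F - (A \<inter> F)" "G - A"] by blast
qed

text \<open>Both patterns are expressed by inclusions alone, so a map that preserves and reflects
  inclusion transports them; reflection also makes it injective.\<close>

lemma arrows_image_iff:
  assumes "\<And>S T. S \<in> F \<Longrightarrow> T \<in> F \<Longrightarrow> g S \<subseteq> g T \<longleftrightarrow> S \<subseteq> T"
  shows "arrows (g ` F) \<longleftrightarrow> arrows F"
proof -
  have inj: "inj_on g F"
    using assms by (fastforce intro: inj_onI)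
  have 11: "has_V11 (g ` A) \<longleftrightarrow> has_V11 A" and 22: "has_V22 (g ` A) \<longleftrightarrow> has_V22 A" if "A \<subseteq> F" for A
  proof -
    have "g S \<subseteq> g T \<longleftrightarrow> S \<subseteq> T" if "S \<in> A" "T \<in> A" for S T
      using that \<open>A \<subseteq> F\<close> assms by blast
    then show "has_V11 (g ` A) \<longleftrightarrow> has_V11 A" "has_V22 (g ` A) \<longleftrightarrow> has_V22 A"
      by (simp_all add: has_V11_def has_V22_def less_le_not_le cong: bex_cong)
  qed
  have "has_V11 (g ` A) \<or> has_V22 (g ` F - g ` A) \<longleftrightarrow> has_V11 A \<or> has_V22 (F - A)" if "A \<subseteq> F" for A
    using that 11[of A] 22[of "F - A"] inj by (simp add: inj_on_image_set_diff[symmetric])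
  then show ?thesis
    unfolding arrows_def by (simp add: all_subset_image)
qed

text \<open>A permutation of \<open>X\<close> induces an automorphism of the inclusion order on
  \<open>Pow X\<close>. This is what reduces the computations to one representative per
  orbit.\<close>

lemma arrows_relabel_iff:
  assumes "bij_betw f X X" "M \<subseteq> Pow X"
  shows "arrows (Pow X - (`) f ` M) \<longleftrightarrow> arrows (Pow X - M)"
proof -
  have "bij_betw ((`) f) (Pow X) (Pow X)"
    using assms(1) by (rule bij_betw_Pow)
  then have "Pow X - (`) f ` M = (`) f ` (Pow X - M)"
    using assms(2) by (simp add: bij_betw_def inj_on_image_set_diff[where C = "Pow X"])
  moreover have "f ` S \<subseteq> f ` T \<longleftrightarrow> S \<subseteq> T" if "S \<in> Pow X - M" "T \<in> Pow X - M" for S T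
  proof -
    \<comment> \<open>Inclusion in \<open>T\<close> is rewritten as an equation between unions, to
      which injectivity of \<open>f\<close> on \<open>X\<close> applies.\<close>
    have "f ` (S \<union> T) = f ` T \<longleftrightarrow> S \<union> T = T"
      using assms(1) that by (intro inj_on_image_eq_iff[of f X]) (auto simp: bij_betw_def)
    then show ?thesis
      by (simp add: image_Un subset_Un_eq)
  qed
  ultimately show ?thesis
    using arrows_image_iff[of "Pow X - M" "(`) f"] by simp
qed

section \<open>Families given by lists\<close>

text \<open>Here and in \<open>V22_list\<close>, each test stands as soon as the sets it mentions
  are chosen, so that evaluation discards failing branches early.\<close>

definition V11_list :: "'a set list \<Rightarrow> ('a set \<times> 'a set \<times> 'a set) list" where
  "V11_list L = [(x, y, z). x \<leftarrow> L, y \<leftarrow> L, x \<subset> y, z \<leftarrow> L, x \<subset> z, \<not> y \<subseteq> z, \<not> z \<subseteq> y]"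

definition V22_list :: "'a set list \<Rightarrow> ('a set \<times> 'a set \<times> 'a set \<times> 'a set \<times> 'a set) list" where
  "V22_list L = [(x, y, y', z, z'). x \<leftarrow> L, y \<leftarrow> L, x \<subset> y, y' \<leftarrow> L, y \<subset> y',
     z \<leftarrow> L, x \<subset> z, \<not> z \<subseteq> y', z' \<leftarrow> L, z \<subset> z', \<not> y \<subseteq> z']"

lemma set_V11_list:
  "set (V11_list L) = {(x, y, z). x \<in> set L \<and> y \<in> set L \<and> z \<in> set L \<and>
     x \<subset> y \<and> x \<subset> z \<and> \<not> y \<subseteq> z \<and> \<not> z \<subseteq> y}"
  unfolding V11_list_def
  by (rule set_eqI) (simp add: if_distrib[of set] if_distrib[of "\<lambda>A. _ \<in> A"] split_paired_all
      cong: if_cong, blast)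

lemma set_V22_list:
  "set (V22_list L) = {(x, y, y', z, z'). x \<in> set L \<and> y \<in> set L \<and> y' \<in> set L \<and> z \<in> set L \<and> z' \<in> set L \<and>
     x \<subset> y \<and> y \<subset> y' \<and> x \<subset> z \<and> z \<subset> z' \<and> \<not> y \<subseteq> z' \<and> \<not> z \<subseteq> y'}"
  unfolding V22_list_def
  by (rule set_eqI) (simp add: if_distrib[of set] if_distrib[of "\<lambda>A. _ \<in> A"] split_paired_all
      cong: if_cong, blast)

lemma has_V11_set: "has_V11 (set L) \<longleftrightarrow> V11_list L \<noteq> []"
proof -
  have "has_V11 (set L) \<longleftrightarrow> (\<exists>x y z. (x, y, z) \<in> set (V11_list L))"
    unfolding set_V11_list has_V11_def Bex_def by simp
  also have "\<dots> \<longleftrightarrow> V11_list L \<noteq> []"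
    by (cases "V11_list L") auto
  finally show ?thesis .
qed

lemma has_V22_set: "has_V22 (set L) \<longleftrightarrow> V22_list L \<noteq> []"
proof -
  have "has_V22 (set L) \<longleftrightarrow> (\<exists>x y y' z z'. (x, y, y', z, z') \<in> set (V22_list L))"
    unfolding set_V22_list has_V22_def Bex_def by simp
  also have "\<dots> \<longleftrightarrow> V22_list L \<noteq> []"
    by (cases "V22_list L") (auto, blast)
  finally show ?thesis .
qed

text \<open>A supposed good colouring is read as a truth assignment, where \<open>c S\<close> says
  that \<open>S\<close> has colour 1. Once the lists are evaluated, the premises are finitely many
  clauses, each forbidding one monochromatic copy.\<close>

lemma arrows_setI:
  assumes "\<And>c. list_all (\<lambda>(x, y, z). \<not> (c x \<and> c y \<and> c z)) (V11_list L) \<Longrightarrow>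
    list_all (\<lambda>(x, y, y', z, z'). c x \<or> c y \<or> c y' \<or> c z \<or> c z') (V22_list L) \<Longrightarrow> False"
  shows "arrows (set L)"
  unfolding arrows_def
proof (intro allI impI, rule ccontr)
  fix A assume A: "\<not> (has_V11 A \<or> has_V22 (set L - A))"
  have V11: "\<not> (x \<in> A \<and> y \<in> A \<and> z \<in> A)" if "(x, y, z) \<in> set (V11_list L)" for x y z
  proof
    assume "x \<in> A \<and> y \<in> A \<and> z \<in> A"
    with that have "has_V11 A"
      unfolding has_V11_def set_V11_list by blast
    with A show False by blast
  qed
  have V22: "x \<in> A \<or> y \<in> A \<or> y' \<in> A \<or> z \<in> A \<or> z' \<in> A"
    if "(x, y, y', z, z') \<in> set (V22_list L)" for x y y' z z'
  proof (rule ccontr)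
    assume "\<not> (x \<in> A \<or> y \<in> A \<or> y' \<in> A \<or> z \<in> A \<or> z' \<in> A)"
    with that have "has_V22 (set L - A)"
      unfolding has_V22_def set_V22_list by blast
    with A show False by blast
  qed
  show False
    by - (rule assms[of "\<lambda>S. S \<in> A"]; use V11 V22 in \<open>fastforce simp: list_all_iff\<close>)
qed

lemma not_arrows_setI:
  assumes "set A \<subseteq> set L" "V11_list A = []" "V22_list [S \<leftarrow> L. S \<notin> set A] = []"
  shows "\<not> arrows (set L)"
proof -
  have "set [S \<leftarrow> L. S \<notin> set A] = set L - set A" by auto
  then have "\<not> has_V11 (set A)" "\<not> has_V22 (set L - set A)"
    using assms(2,3) has_V11_set has_V22_set by metis+
  then show ?thesis
    using assms(1) by (auto simp: arrows_def)
qed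

section \<open>Subsets of a four-element set\<close>

definition subsets4 :: "nat set list" where
  "subsets4 = map set (subseqs [1, 2, 3, 4])"

lemma atLeastAtMost_1_4: "{1..4} = {1, 2, 3, 4 :: nat}"
  by auto

lemma set_subsets4: "set subsets4 = Pow {1..4}"
  unfolding subsets4_def set_map subseqs_powset atLeastAtMost_1_4 by simp

definition perms4 :: "nat list list" where
  "perms4 = filter distinct (List.n_lists 4 [1, 2, 3, 4])"

text \<open>List positions start at 0 and the ground set at 1, hence the shift.\<close>

definition relabel :: "nat list \<Rightarrow> nat \<Rightarrow> nat" where
  "relabel p i = p ! (i - 1)"

lemma bij_betw_relabel:
  assumes "p \<in> set perms4"
  shows "bij_betw (relabel p) {1..4} {1..4}"
proof -
  have "list_all (\<lambda>p. relabel p ` {1, 2, 3, 4} = {1, 2, 3, 4}) perms4"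
    by code_simp
  then have "relabel p ` {1..4} = {1..4}"
    using assms unfolding list_all_iff atLeastAtMost_1_4 by blast
  then show ?thesis
    by (simp add: bij_betw_def eq_card_imp_inj_on)
qed

text \<open>Whether \<open>M\<close> contains a relabelling of a member of \<open>Ns\<close>. Unlike \<open>list_ex\<close>, \<open>find\<close> stops at the
  first success when evaluated by rewriting.\<close>

definition covered :: "nat set list list \<Rightarrow> nat set list \<Rightarrow> bool" where
  "covered Ns M \<longleftrightarrow>
     find (\<lambda>p. find (\<lambda>N. list_all (\<lambda>S. relabel p ` S \<in> set M) N) Ns \<noteq> None) perms4 \<noteq> None"

lemma coveredE:
  assumes "covered Ns M"
  obtains p N where "p \<in> set perms4" "N \<in> set Ns" "(`) (relabel p) ` set N \<subseteq> set M"
proof -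
  have "\<exists>p\<in>set perms4. \<exists>N\<in>set Ns. list_all (\<lambda>S. relabel p ` S \<in> set M) N"
    using assms by (auto simp: covered_def find_None_iff)
  then show thesis
    using that by (auto simp: list_all_iff image_subset_iff)
qed

section \<open>Good pairs\<close>

definition good_pair :: "nat set \<Rightarrow> nat set \<Rightarrow> bool" where
  "good_pair S T \<longleftrightarrow> S = {1..4} - T \<or> card S = 2 \<and> card T = 2"

section \<open>Which deletions leave a Ramsey family\<close>

lemma arrows_canonical:
  "list_all (\<lambda>M. arrows (set [S \<leftarrow> subsets4. S \<notin> set M \<and> S \<noteq> {1, 2, 3, 4}]))
     [[{1}, {2, 3, 4}], [{1, 2}, {3, 4}], [{1, 2}, {1, 3}]]"
  unfolding list.pred_inject(2)
  \<comment> \<open>The code simplifier enumerates all copies of the two posets, which turns the claim into a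
    propositional one with one atom per set.\<close>
  by (intro conjI list.pred_inject(1); rule arrows_setI; code_simp;
      simp only: ball_simps prod.case; sat)

text \<open>A pair \<open>(M, A)\<close> says that after deleting \<open>M\<close>, giving colour 1 to \<open>A\<close> and colour 2 to the rest
  avoids both posets. The first components represent the orbits of the minimal deletions not covered
  by a good pair.\<close>

definition colourings :: "(nat set list \<times> nat set list) list" where
  "colourings =
    (let A = [{}, {1}, {1, 2}, {1, 2, 3}];
         B = [{1, 2}, {1, 3}, {2, 4}, {3, 4}, {1, 2, 4}, {1, 3, 4}]
     in [([{4}, {3}], A), ([{4}, {1, 3}], A), ([{4}, {1, 3, 4}], A), ([{1, 4}, {1, 3, 4}], A),
         ([{1, 3, 4}, {2, 3, 4}], A), ([{4}, {1, 4}], B), ([{1, 4}, {2, 3, 4}], B),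
         ([{1, 4}, {2, 4}, {1, 3}], A), ([{1, 4}, {3, 4}, {1, 3}], A),
         ([{1, 4}, {2, 4}, {3, 4}], [{1, 2}, {1, 3}, {1, 2, 4}, {1, 3, 4}, {2, 3, 4}]),
         ([{}], [{1, 2, 3}, {1, 2, 4}, {1, 3, 4}, {2, 3, 4}])])"

text \<open>Each certificate is checked by evaluation. The set \<open>{1..4}\<close> stays in the
  family, with colour 2, so the result also bounds the families without it.\<close>

lemma not_arrows_colourings:
  assumes "M \<in> fst ` set colourings"
  shows "\<not> arrows (Pow {1..4} - set M)" "set M \<subseteq> Pow {1..4}"
proof -
  have *: "list_all (\<lambda>(M, A). list_all (\<lambda>S. S \<in> set subsets4) M \<and>
      (let L = [S \<leftarrow> subsets4. S \<notin> set M] in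
         list_all (\<lambda>S. S \<in> set L) A \<and> V11_list A = [] \<and> V22_list [S \<leftarrow> L. S \<notin> set A] = [])) colourings"
    by code_simp
  obtain A where A: "(M, A) \<in> set colourings"
    using assms by force
  show "set M \<subseteq> Pow {1..4}"
    using * A unfolding list_all_iff set_subsets4 by fast
  have "\<not> arrows (set [S \<leftarrow> subsets4. S \<notin> set M])"
    using * A by (intro not_arrows_setI[of A]) (auto simp: list_all_iff Let_def)
  moreover have "set [S \<leftarrow> subsets4. S \<notin> set M] = Pow {1..4} - set M"
    unfolding set_subsets4[symmetric] by auto
  ultimately show "\<not> arrows (Pow {1..4} - set M)" by simp
qed

text \<open>A family avoiding \<open>M\<close> lies inside a relabelling of one of the families with
  an explicit good colouring, so monotonicity applies.\<close>

lemma not_arrows_covered: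
  assumes "covered (map fst colourings) M" "F \<inter> set M = {}" "F \<subseteq> Pow {1..4}"
  shows "\<not> arrows F"
proof -
  obtain p N where p: "p \<in> set perms4" and N: "N \<in> fst ` set colourings"
    and sub: "(`) (relabel p) ` set N \<subseteq> set M"
    using coveredE[OF assms(1)] by auto
  have "\<not> arrows (Pow {1..4} - (`) (relabel p) ` set N)"
    using not_arrows_colourings[OF N] arrows_relabel_iff[OF bij_betw_relabel[OF p]] by blast
  moreover have "F \<subseteq> Pow {1..4} - (`) (relabel p) ` set N"
    using sub assms(2,3) by blast
  ultimately show ?thesis
    using arrows_mono by blast
qed

text \<open>The three representatives are a singleton with its complement, two disjoint 2-sets, and
  two 2-sets with one common point. Every good pair is a relabelling of one of them.\<close>

lemma arrows_good_pair:
  assumes "S \<in> Pow {1..4} - {{}, {1..4}}" "T \<in> Pow {1..4} - {{}, {1..4}}" "S \<noteq> T" "good_pair S T"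
  shows "arrows (Pow {1..4} - {S, T, {1..4}})"
proof -
  have "list_all (\<lambda>S. list_all (\<lambda>T. covered [[{1}, {2, 3, 4}], [{1, 2}, {3, 4}], [{1, 2}, {1, 3}]] [S, T])
      [T \<leftarrow> subsets4. S \<noteq> T \<and> T \<noteq> {} \<and> T \<noteq> {1, 2, 3, 4} \<and> good_pair S T])
      [S \<leftarrow> subsets4. S \<noteq> {} \<and> S \<noteq> {1, 2, 3, 4}]"
    by code_simp
  then have "covered [[{1}, {2, 3, 4}], [{1, 2}, {3, 4}], [{1, 2}, {1, 3}]] [S, T]"
    using assms unfolding list_all_iff set_filter set_subsets4 atLeastAtMost_1_4 by blast
  then obtain p N where p: "p \<in> set perms4"
    and N: "N \<in> set [[{1}, {2, 3, 4}], [{1, 2}, {3, 4}], [{1, 2}, {1, 3}]]"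
    and sub: "(`) (relabel p) ` set N \<subseteq> set [S, T]"
    by (rule coveredE)
  have "arrows (set [S \<leftarrow> subsets4. S \<notin> set N \<and> S \<noteq> {1, 2, 3, 4}])"
    using arrows_canonical N unfolding list_all_iff by blast
  moreover have "set [S \<leftarrow> subsets4. S \<notin> set N \<and> S \<noteq> {1, 2, 3, 4}] = Pow {1..4} - (set N \<union> {{1..4}})"
    unfolding set_subsets4[symmetric] atLeastAtMost_1_4[symmetric] by auto
  moreover have "set N \<union> {{1..4}} \<subseteq> Pow {1..4}"
    using N by auto
  ultimately have *: "arrows (Pow {1..4} - (`) (relabel p) ` (set N \<union> {{1..4}}))"
    using arrows_relabel_iff[OF bij_betw_relabel[OF p]] by metis
  \<comment> \<open>Covering yields only an inclusion in \<open>{S, T}\<close>; since both sides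
    have two members, they are equal.\<close>
  have "inj_on ((`) (relabel p)) (Pow {1..4})"
    using bij_betw_relabel[OF p] by (simp add: bij_betw_def inj_on_image_Pow)
  then have "card ((`) (relabel p) ` set N) = card (set N)"
    by (rule card_image[OF inj_on_subset]) (use N in auto)
  also have "\<dots> = 2"
    using N by (auto simp: doubleton_eq_iff)
  finally have "(`) (relabel p) ` set N = {S, T}"
    using sub \<open>S \<noteq> T\<close> by (intro card_subset_eq) auto
  moreover have "relabel p ` {1..4} = {1..4}"
    using bij_betw_relabel[OF p] by (simp add: bij_betw_def)
  ultimately have "(`) (relabel p) ` (set N \<union> {{1..4}}) = {S, T, {1..4}}"
    by (simp add: image_Un insert_commute)
  with * show ?thesis by simp
qed

text \<open>Up to permutation, a bad pair is determined by the two sizes and by whether the smaller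
  set lies in the larger one. This gives the seven pairs in \<open>colourings\<close>.\<close>

lemma not_arrows_bad_pair:
  assumes "S \<in> Pow {1..4} - {{}, {1..4}}" "T \<in> Pow {1..4} - {{}, {1..4}}" "S \<noteq> T" "\<not> good_pair S T"
    and "F \<subseteq> Pow {1..4}" "S \<notin> F" "T \<notin> F"
  shows "\<not> arrows F"
proof (rule not_arrows_covered)
  have "list_all (\<lambda>S. list_all (\<lambda>T. covered (map fst colourings) [S, T])
      [T \<leftarrow> subsets4. S \<noteq> T \<and> T \<noteq> {} \<and> T \<noteq> {1, 2, 3, 4} \<and> \<not> good_pair S T])
      [S \<leftarrow> subsets4. S \<noteq> {} \<and> S \<noteq> {1, 2, 3, 4}]"
    by code_simp
  then show "covered (map fst colourings) [S, T]"
    using assms(1-4) unfolding list_all_iff set_filter set_subsets4 atLeastAtMost_1_4 by blast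
qed (use assms in auto)

text \<open>Seen as edges of the complete graph on four points, three 2-sets form a path, a triangle
  or a star. These are the three triples in \<open>colourings\<close>.\<close>

lemma not_arrows_middle_triple:
  fixes F :: "nat set set"
  assumes "card R = 2" "card S = 2" "card T = 2" "R \<noteq> S" "R \<noteq> T" "S \<noteq> T"
    and "{R, S, T} \<subseteq> Pow {1..4}" "F \<subseteq> Pow {1..4}" "F \<inter> {R, S, T} = {}"
  shows "\<not> arrows F"
proof (rule not_arrows_covered)
  have "let L = [S \<leftarrow> subsets4. card S = 2] in
      list_all (\<lambda>R. list_all (\<lambda>S. list_all (\<lambda>T. covered (map fst colourings) [R, S, T])
        [T \<leftarrow> L. R \<noteq> T \<and> S \<noteq> T]) [S \<leftarrow> L. R \<noteq> S]) L"
    by code_simp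
  then show "covered (map fst colourings) [R, S, T]"
    using assms(1-7) unfolding list_all_iff Let_def set_filter set_subsets4 by blast
qed (use assms in auto)

text \<open>The 3-sets form an antichain and get colour 1. Among the remaining nonempty sets, every
  chain of three ends in \<open>{1..4}\<close>, so a copy of the larger vee would lack incomparable
  tops.\<close>

lemma not_arrows_no_empty:
  fixes F :: "nat set set"
  assumes "F \<subseteq> Pow {1..4}" "{} \<notin> F"
  shows "\<not> arrows F"
proof (rule not_arrows_covered)
  show "covered (map fst colourings) [{}]"
    by code_simp
qed (use assms in auto)

text \<open>Any two missing proper subsets form a good pair and no three of them all have size 2,
  which allows at most two missing sets. Smaller deletions extend to a good pair.\<close>

lemma arrows_iff:
  assumes F: "F \<subseteq> Pow {1..4}"
  shows "arrows F \<longleftrightarrow> (\<exists>S T. S \<in> Pow {1..4} - {{}, {1..4}} \<and> T \<in> Pow {1..4} - {{}, {1..4}} \<and> S \<noteq> T \<and>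
    good_pair S T \<and> Pow {1..4} - {S, T, {1..4}} \<subseteq> F)"
    (is "_ \<longleftrightarrow> (\<exists>S T. ?good S T)")
proof
  assume "arrows F"
  define M where "M = Pow {1..4} - {{1..4}} - F"
  have M: "M \<subseteq> Pow {1..4} - {{}, {1..4}}"
    using not_arrows_no_empty[OF F] \<open>arrows F\<close> by (auto simp: M_def)
  have pair: "good_pair S T" if "S \<in> M" "T \<in> M" "S \<noteq> T" for S T
    using not_arrows_bad_pair[of S T F] that M F \<open>arrows F\<close> by (auto simp: M_def)
  have triple: False
    if "R \<in> M" "S \<in> M" "T \<in> M" "R \<noteq> S" "R \<noteq> T" "S \<noteq> T" "card R = 2" "card S = 2" "card T = 2" for R S T
    using not_arrows_middle_triple[of R S T F] that F \<open>arrows F\<close> by (auto simp: M_def)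
  have goodI: "?good S T" if "S \<in> Pow {1..4} - {{}, {1..4}}" "T \<in> Pow {1..4} - {{}, {1..4}}" "S \<noteq> T"
    "good_pair S T" "M \<subseteq> {S, T}" for S T
    using that by (auto simp: M_def)
  \<comment> \<open>A deletion of at most one set is completed to a good pair by a complement; if
    nothing is missing, any nonempty proper \<open>S\<close> serves.\<close>
  have compl: "\<exists>S T. ?good S T" if "S \<in> Pow {1..4} - {{}, {1..4}}" "M \<subseteq> {S}" for S
  proof -
    have "{1..4} - S \<in> Pow {1..4} - {{}, {1..4}}" "S \<noteq> {1..4} - S"
      using that(1) by blast+
    moreover have "good_pair S ({1..4} - S)"
      using that(1) by (simp add: good_pair_def double_diff)
    moreover have "M \<subseteq> {S, {1..4} - S}"
      using that(2) by blast
    ultimately show ?thesis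
      using that(1) goodI by meson
  qed
  show "\<exists>S T. ?good S T"
  proof (cases "\<exists>S\<in>M. \<exists>T\<in>M. S \<noteq> T")
    case True
    then obtain S T where ST: "S \<in> M" "T \<in> M" "S \<noteq> T" by blast
    have "R \<in> {S, T}" if "R \<in> M" for R
    proof (rule ccontr)
      assume R: "R \<notin> {S, T}"
      then have "good_pair S T" "good_pair R S" "good_pair R T"
        using ST that by (auto intro: pair)
      moreover have "S \<subseteq> {1..4}" "T \<subseteq> {1..4}" "R \<subseteq> {1..4}"
        using ST that M by auto
      \<comment> \<open>If one of the three were not of size 2, it would be the complement of both
        others, which would then be equal.\<close>
      ultimately have "card R = 2" "card S = 2" "card T = 2"
        using R ST(3) unfolding good_pair_def by (metis double_diff order_refl insertCI)+
      then show False
        using triple[of R S T] R ST that by blast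
    qed
    then have "M \<subseteq> {S, T}" by blast
    then show ?thesis
      using goodI[OF subsetD[OF M ST(1)] subsetD[OF M ST(2)] ST(3) pair[OF ST]] by (intro exI)
  next
    case False
    show ?thesis
    proof (cases "M = {}")
      case True
      have "{1} \<in> Pow {1..4} - {{}, {1..4 :: nat}}"
        unfolding atLeastAtMost_1_4 by simp
      then show ?thesis
        by (rule compl) (simp add: True)
    next
      case nonempty: False
      then obtain S where "S \<in> M" by blast
      then show ?thesis
        using M False by (intro compl[of S]) blast+
    qed
  qed
next
  assume "\<exists>S T. ?good S T"
  then obtain S T where "?good S T" by (elim exE)
  then show "arrows F"
    using arrows_mono[OF arrows_good_pair[of S T]] by simp
qed

section \<open>Minimal families and their isomorphism types\<close>

theorem theorem4:
  fixes P :: "'a rel"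
  assumes "Partial_order P"
  shows "minimal_ramsey 4 (vee 1 1) (vee 2 2) P \<longleftrightarrow>
    (\<exists>S1 S2. S1 \<in> Pow {1..4} - {{1..4}} \<and> S2 \<in> Pow {1..4} - {{1..4}} \<and>
       S1 \<noteq> {} \<and> S2 \<noteq> {} \<and> S1 \<noteq> S2 \<and>
       (S1 = {1..4} - S2 \<or> card S1 = 2 \<and> card S2 = 2) \<and>
       poset_isomorphic P
         (Restr (boolean_lattice 4) (Pow {1..4} - {S1, S2, {1..4}})))"
    (is "_ \<longleftrightarrow> ?R")
proof
  assume min: "minimal_ramsey 4 (vee 1 1) (vee 2 2) P"
  then obtain f where f: "poset_embedding P (boolean_lattice 4) f"
    unfolding minimal_ramsey_def contains_poset_def by blast
  have arrows: "arrows (f ` Field P)" and minimal: "\<And>S. S \<in> f ` Field P \<Longrightarrow> \<not> arrows (f ` Field P - {S})"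
    using min minimal_ramsey_vee_iff[OF assms f] by auto
  have sub: "f ` Field P \<subseteq> Pow {1..4}"
    using f by (simp add: embedding_boolean_lattice_iff)
  obtain S T where ST: "S \<in> Pow {1..4} - {{}, {1..4}}" "T \<in> Pow {1..4} - {{}, {1..4}}" "S \<noteq> T"
    "good_pair S T" and le: "Pow {1..4} - {S, T, {1..4}} \<subseteq> f ` Field P"
    using arrows unfolding arrows_iff[OF sub] by (elim exE conjE)
  have "f ` Field P = Pow {1..4} - {S, T, {1..4}}"
  proof (rule ccontr)
    assume "f ` Field P \<noteq> Pow {1..4} - {S, T, {1..4}}"
    \<comment> \<open>The inclusion \<open>le\<close> is strict, so a surplus \<open>R\<close> can
      be deleted while a Ramsey family remains, against minimality.\<close>
    with le obtain R where R: "R \<in> f ` Field P" "Pow {1..4} - {S, T, {1..4}} \<subseteq> f ` Field P - {R}"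
      by blast
    show False
      using minimal[OF R(1)] arrows_mono[OF arrows_good_pair[OF ST] R(2)] by contradiction
  qed
  then have "poset_isomorphic P (Restr (boolean_lattice 4) (Pow {1..4} - {S, T, {1..4}}))"
    unfolding poset_isomorphic_Restr_iff[OF Diff_subset] using f by (intro exI[of _ f] conjI)
  then show ?R
    using ST unfolding good_pair_def by (intro exI[of _ S] exI[of _ T]) simp
next
  assume ?R
  then obtain S T where "S \<in> Pow {1..4} - {{1..4}}" "T \<in> Pow {1..4} - {{1..4}}" "S \<noteq> {}" "T \<noteq> {}"
    and "S \<noteq> T" "S = {1..4} - T \<or> card S = 2 \<and> card T = 2"
    and iso: "poset_isomorphic P (Restr (boolean_lattice 4) (Pow {1..4} - {S, T, {1..4}}))"
    by (elim exE conjE)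
  then have ST: "S \<in> Pow {1..4} - {{}, {1..4}}" "T \<in> Pow {1..4} - {{}, {1..4}}" "S \<noteq> T" "good_pair S T"
    unfolding good_pair_def by blast+
  from iso obtain f where f: "poset_embedding P (boolean_lattice 4) f"
    and im: "f ` Field P = Pow {1..4} - {S, T, {1..4}}"
    unfolding poset_isomorphic_Restr_iff[OF Diff_subset] by (elim exE conjE)
  \<comment> \<open>If deleting \<open>R\<close> left a Ramsey family, the three distinct sets
    \<open>S\<close>, \<open>T\<close>, \<open>R\<close> would all have to belong to a single good
    pair.\<close>
  have "\<not> arrows (Pow {1..4} - {S, T, {1..4}} - {R})" if "R \<in> Pow {1..4} - {S, T, {1..4}}" for R
  proof
    have "Pow {1..4} - {S, T, {1..4}} - {R} \<subseteq> Pow {1..4}" by blast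
    assume "arrows (Pow {1..4} - {S, T, {1..4}} - {R})"
    then obtain S' T' where "S' \<in> Pow {1..4} - {{}, {1..4}}" "T' \<in> Pow {1..4} - {{}, {1..4}}" "S' \<noteq> T'"
      and "Pow {1..4} - {S', T', {1..4}} \<subseteq> Pow {1..4} - {S, T, {1..4}} - {R}"
      unfolding arrows_iff[OF \<open>_ \<subseteq> Pow {1..4}\<close>] by (elim exE conjE)
    then have "{S, T, R} \<subseteq> {S', T'}"
      using ST that by blast
    then have "card {S, T, R} \<le> card {S', T'}"
      by (intro card_mono) auto
    also have "\<dots> \<le> 2"
      by (simp add: card_insert_if)
    finally show False
      using ST(3) that by (auto simp: card_insert_if split: if_splits)
  qed
  then show "minimal_ramsey 4 (vee 1 1) (vee 2 2) P"
    unfolding minimal_ramsey_vee_iff[OF assms f] im using arrows_good_pair[OF ST] by blast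
qed

end
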